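(* Let $G$ be a group and $H\leq G$. If $H$ is a $k$-nilpotent subgroup, then the envelope $E_k(H)$ is also $k$-nilpotent.
   Context: Natural numbers include $0$. Commutators are $[g,h]=g^{-1}h^{-1}gh$, and for an element $g$ and a subset $S$ of a group, $[g,S]=\{[g,s]\mid s\in S\}$. The upper central series of a group $G$ is given by $Z_0(G)=1$ and $Z_{j+1}(G)=\{g\in G\mid [g,G]\subseteq Z_j(G)\}$ for $j\in\mathbb{N}$. A group $G$ is nilpotent if $Z_j(G)=G$ for some $j\in\mathbb{N}$, and the least such $j$ is its nilpotency class; "$k$-nilpotent" means nilpotent of class $k$. Iterated centralizers: for a group $G$ and a subset $A\subseteq G$, set $C_G^0(A)=1$ and for $j\geq 1$ $$C_G^j(A)=\Big\{x\in\bigcap_{n<j}N_G\big(C_G^n(A)\big)\;\Big|\;[x,A]\subseteq C_G^{j-1}(A)\Big\},$$ where $N_G$ denotes the normalizer in $G$. Envelopes: for a group $G$ and a subgroup $H\leq G$, set $E_0(H)=G$ and for $j\in\mathbb{N}$ $$E_{j+1}(H)=\Big\{g\in E_j(H)\;\Big|\;\big[g,C_{E_j(H)}^{j+1}(H)\big]\subseteq C_{E_j(H)}^{j}(H)\Big\},$$ where the iterated centralizers are computed in the group $E_j(H)$. These form a descending chain of subgroups $G=E_0(H)\geq E_1(H)\geq\cdots\geq H$.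
   Formalization: The formal theorem assumes k ≥ 1: for k = 0 the subgroup H is trivial and E_0(H) = G, so the claim fails for every nontrivial group G. *)

theory Defs
  imports "HOL-Algebra.Algebra"
begin

definition commutator :: "('a, 'b) monoid_scheme \<Rightarrow> 'a \<Rightarrow> 'a \<Rightarrow> 'a" where
  "commutator G g h = inv\<^bsub>G\<^esub> g \<otimes>\<^bsub>G\<^esub> inv\<^bsub>G\<^esub> h \<otimes>\<^bsub>G\<^esub> g \<otimes>\<^bsub>G\<^esub> h"

definition commutator_set :: "('a, 'b) monoid_scheme \<Rightarrow> 'a \<Rightarrow> 'a set \<Rightarrow> 'a set" where
  "commutator_set G g S = {commutator G g s | s. s \<in> S}"

primrec upper_central :: "('a, 'b) monoid_scheme \<Rightarrow> nat \<Rightarrow> 'a set" where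
  "upper_central G 0 = {\<one>\<^bsub>G\<^esub>}"
| "upper_central G (Suc j) =
     {g \<in> carrier G. commutator_set G g (carrier G) \<subseteq> upper_central G j}"

definition nilpotent_group :: "('a, 'b) monoid_scheme \<Rightarrow> bool" where
  "nilpotent_group G \<longleftrightarrow> group G \<and> (\<exists>j. upper_central G j = carrier G)"

definition nilpotency_class :: "('a, 'b) monoid_scheme \<Rightarrow> nat" where
  "nilpotency_class G = (LEAST j. upper_central G j = carrier G)"

definition k_nilpotent :: "nat \<Rightarrow> ('a, 'b) monoid_scheme \<Rightarrow> bool" where
  "k_nilpotent k G \<longleftrightarrow> nilpotent_group G \<and> nilpotency_class G = k"

fun iterated_centralizer :: "('a, 'b) monoid_scheme \<Rightarrow> 'a set \<Rightarrow> nat \<Rightarrow> 'a set" where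
  "iterated_centralizer G A 0 = {\<one>\<^bsub>G\<^esub>}"
| "iterated_centralizer G A (Suc j) =
     {x \<in> (\<Inter>n\<in>{..<Suc j}. normalizer G (iterated_centralizer G A n)).
        commutator_set G x A \<subseteq> iterated_centralizer G A j}"

(* envelope G H 0 is all of G whatever H is, so the envelope of index k can inherit
   nilpotency class k from H only for k > 0: for k = 0 the subgroup H is trivial but
   G is arbitrary. The iterated centralizers are those of the group on the previous
   envelope; the normalizers inside them are therefore relative to that group too. *)
primrec envelope :: "('a, 'b) monoid_scheme \<Rightarrow> 'a set \<Rightarrow> nat \<Rightarrow> 'a set" where
  "envelope G H 0 = carrier G"
| "envelope G H (Suc j) =
     {g \<in> envelope G H j.
        commutator_set G g (iterated_centralizer (G\<lparr>carrier := envelope G H j\<rparr>) H (Suc j))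
          \<subseteq> iterated_centralizer (G\<lparr>carrier := envelope G H j\<rparr>) H j}"

end

theory Submission
  imports Defs
begin

text \<open>
  Write \<open>E\<^sub>j\<close> for the envelopes of \<open>H\<close>, \<open>Z\<^sub>m\<close> for the terms of the upper central series and
  \<open>C\<^sup>m\<close> for the iterated centralizers of \<open>H\<close>. The theorem rests on an invariant: for \<open>m \<le> j\<close>, the
  iterated centralizer \<open>C\<^sup>m\<close> computed inside \<open>E\<^sub>j\<close> equals \<open>Z\<^sub>m(E\<^sub>j)\<close> (\<open>envelope_invariant\<close>). So in
  the \<open>j\<close>-th envelope, commuting with \<open>H\<close> at the first \<open>j\<close> levels is the same as commuting with
  everything.

  The invariant propagates because, once it holds, all the normalizers in the definition of
  \<open>C\<^sup>j\<^sup>+\<^sup>1\<close> are the whole of \<open>E\<^sub>j\<close>, so that \<open>C\<^sup>j\<^sup>+\<^sup>1\<close> is simply the centralizer of \<open>H\<close> modulo the normal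
  subgroup \<open>Z\<^sub>j(E\<^sub>j)\<close>, and \<open>E\<^sub>j\<^sub>+\<^sub>1\<close> is its double centralizer modulo \<open>Z\<^sub>j(E\<^sub>j)\<close>. As in the classical case
  \<open>j = 0\<close>, where \<open>E\<^sub>1\<close> is the double centralizer of \<open>H\<close> and so meets the centralizer of \<open>H\<close> exactly
  in its own centre, an element of the double centralizer that commutes with \<open>H\<close> modulo
  \<open>Z\<^sub>j(E\<^sub>j)\<close> commutes with all of \<open>E\<^sub>j\<^sub>+\<^sub>1\<close> modulo \<open>Z\<^sub>j(E\<^sub>j)\<close>. This is \<open>double_centralizer_step\<close>. At
  the levels \<open>m \<le> j\<close>, the iterated centralizer and the central term of \<open>E\<^sub>j\<^sub>+\<^sub>1\<close> are both the
  intersection of \<open>E\<^sub>j\<^sub>+\<^sub>1\<close> with \<open>Z\<^sub>m(E\<^sub>j)\<close>.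

  Now let \<open>H\<close> have class \<open>k = j + 1\<close>. Then \<open>H = Z\<^sub>k(H)\<close> is contained in \<open>C\<^sup>k\<close> computed in \<open>E\<^sub>j\<close>,
  which says that \<open>H\<close> is abelian modulo \<open>Z\<^sub>j(E\<^sub>j)\<close>. The double centralizer \<open>E\<^sub>k\<close> of \<open>H\<close> is then
  contained in the single one, so every element of \<open>E\<^sub>k\<close> is central modulo \<open>Z\<^sub>j(E\<^sub>j)\<close> and
  \<open>E\<^sub>k = Z\<^sub>k(E\<^sub>k)\<close> (\<open>upper_central_envelope\<close>). The class of \<open>E\<^sub>k\<close> cannot be smaller because \<open>E\<^sub>k\<close>
  contains \<open>H\<close>.
\<close>

section \<open>Centralizers modulo a normal subgroup\<close>

\<comment> \<open>The successor levels are handled through centralizers modulo a subgroup, which unfolding the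
  recursions would hide.\<close>
declare upper_central.simps(2) [simp del] iterated_centralizer.simps(2) [simp del]
  envelope.simps(2) [simp del]

text \<open>
  When \<open>N\<close> is normal, this is the preimage in \<open>G\<close> of the centralizer of \<open>AN/N\<close> in \<open>G/N\<close>. Working
  with commutators in \<open>G\<close> itself keeps the terms \<open>Z\<^sub>j\<close> of different envelopes comparable as sets.
\<close>

definition centralizer_mod :: "('a, 'b) monoid_scheme \<Rightarrow> 'a set \<Rightarrow> 'a set \<Rightarrow> 'a set" where
  "centralizer_mod G N A = {g \<in> carrier G. \<forall>a\<in>A. commutator G g a \<in> N}"

lemma commutator_set_subset_iff: "commutator_set G g A \<subseteq> N \<longleftrightarrow> (\<forall>a\<in>A. commutator G g a \<in> N)"
  by (auto simp: commutator_set_def)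

lemma upper_central_Suc_eq:
  "upper_central G (Suc n) = centralizer_mod G (upper_central G n) (carrier G)"
  by (simp add: upper_central.simps centralizer_mod_def commutator_set_subset_iff)

lemma centralizer_mod_antimono: "A \<subseteq> B \<Longrightarrow> centralizer_mod G N B \<subseteq> centralizer_mod G N A"
  by (auto simp: centralizer_mod_def)

context group
begin

lemma inv_mult_cancel_left:
  "\<lbrakk>x \<in> carrier G; y \<in> carrier G\<rbrakk> \<Longrightarrow> inv x \<otimes> (x \<otimes> y) = y"
  "\<lbrakk>x \<in> carrier G; y \<in> carrier G\<rbrakk> \<Longrightarrow> x \<otimes> (inv x \<otimes> y) = y"
  by (simp_all flip: m_assoc)

lemma commutator_closed [simp]:
  "\<lbrakk>x \<in> carrier G; y \<in> carrier G\<rbrakk> \<Longrightarrow> commutator G x y \<in> carrier G"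
  by (simp add: commutator_def)

lemma inv_commutator:
  "\<lbrakk>x \<in> carrier G; y \<in> carrier G\<rbrakk> \<Longrightarrow> inv (commutator G x y) = commutator G y x"
  by (simp add: commutator_def inv_mult_group m_assoc)

lemma commutator_mem_swap:
  assumes "subgroup N G" "x \<in> carrier G" "y \<in> carrier G" "commutator G x y \<in> N"
  shows "commutator G y x \<in> N"
  using subgroup.m_inv_closed[OF assms(1,4)] assms(2,3) by (simp add: inv_commutator)

lemma commutator_mult_left:
  assumes "x \<in> carrier G" "y \<in> carrier G" "a \<in> carrier G"
  shows "commutator G (x \<otimes> y) a = (inv y \<otimes> commutator G x a \<otimes> y) \<otimes> commutator G y a"
  using assms by (simp add: commutator_def inv_mult_group m_assoc inv_mult_cancel_left)

lemma commutator_inv_left: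
  assumes "x \<in> carrier G" "a \<in> carrier G"
  shows "commutator G (inv x) a = x \<otimes> inv (commutator G x a) \<otimes> inv x"
  using assms by (simp add: commutator_def inv_mult_group m_assoc inv_mult_cancel_left)

text \<open>
  Both closure properties come from the commutator identities above, in which normality of \<open>N\<close>
  absorbs the conjugations.
\<close>

lemma subgroup_centralizer_mod:
  assumes N: "N \<lhd> G" and A: "A \<subseteq> carrier G"
  shows "subgroup (centralizer_mod G N A) G"
proof (rule subgroupI)
  interpret N: normal N G by fact
  show "centralizer_mod G N A \<subseteq> carrier G"
    by (auto simp: centralizer_mod_def)
  have "commutator G \<one> a \<in> N" if "a \<in> A" for a
    using that A by (auto simp: commutator_def)
  then show "centralizer_mod G N A \<noteq> {}"
    by (auto simp: centralizer_mod_def)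
  show "inv x \<in> centralizer_mod G N A" if "x \<in> centralizer_mod G N A" for x
    using that A by (auto simp: centralizer_mod_def commutator_inv_left N.inv_op_closed2 subset_iff)
  show "x \<otimes> y \<in> centralizer_mod G N A"
    if "x \<in> centralizer_mod G N A" "y \<in> centralizer_mod G N A" for x y
    using that A by (auto simp: centralizer_mod_def commutator_mult_left N.inv_op_closed1 subset_iff)
qed

lemma normal_subset_centralizer_mod:
  assumes N: "N \<lhd> G" and A: "A \<subseteq> carrier G"
  shows "N \<subseteq> centralizer_mod G N A"
proof
  interpret N: normal N G by fact
  fix x assume x: "x \<in> N"
  have "commutator G x a = inv x \<otimes> (inv a \<otimes> x \<otimes> a)" if "a \<in> carrier G" for a
    using x that by (simp add: commutator_def m_assoc)
  then show "x \<in> centralizer_mod G N A"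
    using x A by (auto simp: centralizer_mod_def N.inv_op_closed1 subset_iff)
qed

text \<open>
  Conjugation changes \<open>x \<in> Z\<^sub>n\<^sub>+\<^sub>1\<close> only by a commutator with \<open>x\<close>, hence by a factor from
  \<open>Z\<^sub>n \<subseteq> Z\<^sub>n\<^sub>+\<^sub>1\<close>.
\<close>

lemma upper_central_normal: "upper_central G n \<lhd> G"
proof (induction n)
  case 0
  show ?case using one_is_normal by simp
next
  case (Suc n)
  let ?Z = "upper_central G (Suc n)"
  interpret Z: subgroup ?Z G
    unfolding upper_central_Suc_eq by (rule subgroup_centralizer_mod[OF Suc]) simp
  have step: "upper_central G n \<subseteq> ?Z"
    unfolding upper_central_Suc_eq by (rule normal_subset_centralizer_mod[OF Suc]) simp
  have "g \<otimes> x \<otimes> inv g \<in> ?Z" if g: "g \<in> carrier G" and x: "x \<in> ?Z" for g x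
  proof -
    have "commutator G x (inv g) \<in> upper_central G n"
      using g x unfolding upper_central_Suc_eq centralizer_mod_def by simp
    with step have "x \<otimes> commutator G x (inv g) \<in> ?Z" using x by blast
    moreover have "x \<otimes> commutator G x (inv g) = g \<otimes> x \<otimes> inv g"
      using g Z.mem_carrier[OF x] by (simp add: commutator_def m_assoc inv_mult_cancel_left)
    ultimately show ?thesis by (simp only:)
  qed
  then show ?case
    using Z.subgroup_axioms normal_inv_iff by blast
qed

lemma upper_central_subset_carrier: "upper_central G n \<subseteq> carrier G"
  by (rule normal_imp_subgroup[OF upper_central_normal, THEN subgroup.subset])

lemma normalizer_normal_eq:
  assumes "N \<lhd> G"
  shows "normalizer G N = carrier G"
proof -
  interpret N: normal N G by fact
  have "(g <# N) #> inv g = N" if "g \<in> carrier G" for g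
    using that by (simp flip: N.coset_eq add: N.subset coset_mult_assoc)
  then show ?thesis
    using N.subset by (auto simp: normalizer_def stabilizer_def)
qed

section \<open>Iterated centralizers that agree with the upper central series\<close>

text \<open>
  The terms \<open>Z\<^sub>m\<close> are normal in \<open>G\<close>, so the normalizer conditions on the next iterated centralizer
  hold automatically.
\<close>

lemma iterated_centralizer_Suc_eq:
  assumes central: "\<forall>m\<le>n. iterated_centralizer G H m = upper_central G m"
  shows "iterated_centralizer G H (Suc n) = centralizer_mod G (upper_central G n) H"
proof -
  have "normalizer G (iterated_centralizer G H m) = carrier G" if "m < Suc n" for m
    using that central[rule_format, of m] normalizer_normal_eq[OF upper_central_normal] by simp
  then show ?thesis
    using central by (auto simp: iterated_centralizer.simps(2) centralizer_mod_def commutator_set_subset_iff)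
qed

lemma commutator_restrict:
  assumes "subgroup E G" "x \<in> E" "y \<in> E"
  shows "commutator (G\<lparr>carrier := E\<rparr>) x y = commutator G x y"
  using assms by (simp add: commutator_def m_inv_consistent)

lemma centralizer_mod_restrict:
  assumes "subgroup E G" "A \<subseteq> E"
  shows "centralizer_mod (G\<lparr>carrier := E\<rparr>) N A = E \<inter> centralizer_mod G N A"
  using assms subgroup.subset[OF assms(1)]
  by (auto simp: centralizer_mod_def commutator_restrict subset_iff)

text \<open>
  Commutators of elements of \<open>E\<close> stay in \<open>E\<close>, so \<open>N\<close> may be traded for its trace on \<open>E\<close>. This lets
  one compare \<open>Z\<^sub>j(E)\<close> with \<open>Z\<^sub>j(G)\<close> as moduli.
\<close>

lemma centralizer_mod_inter:
  assumes E: "subgroup E G" and A: "A \<subseteq> E"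
  shows "E \<inter> centralizer_mod G (E \<inter> N) A = E \<inter> centralizer_mod G N A"
proof -
  have "commutator G g a \<in> E" if "g \<in> E" "a \<in> A" for g a
    using group.commutator_closed[OF subgroup_imp_group[OF E], of g a]
      commutator_restrict[OF E, of g a] that A by auto
  then show ?thesis by (auto simp: centralizer_mod_def)
qed

lemma upper_central_inter_subset:
  assumes E: "subgroup E G"
  shows "E \<inter> upper_central G n \<subseteq> upper_central (G\<lparr>carrier := E\<rparr>) n"
proof (induction n)
  case (Suc n)
  have "E \<inter> upper_central G (Suc n) \<subseteq> E \<inter> centralizer_mod G (upper_central G n) E"
    unfolding upper_central_Suc_eq using centralizer_mod_antimono[OF subgroup.subset[OF E]] by blast
  also have "\<dots> = E \<inter> centralizer_mod G (E \<inter> upper_central G n) E"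
    using centralizer_mod_inter[OF E] by blast
  also have "\<dots> \<subseteq> upper_central (G\<lparr>carrier := E\<rparr>) (Suc n)"
    using Suc unfolding upper_central_Suc_eq
    by (subst centralizer_mod_restrict[OF E]) (auto simp: centralizer_mod_def)
  finally show ?case .
qed auto

text \<open>
  The invariant is assumed up to \<open>j\<close>, yet the conclusion reaches level \<open>j + 1\<close>. For a subgroup \<open>H\<close>
  of class \<open>j + 1\<close> this extra level is what places all of \<open>H\<close> in \<open>C\<^sup>j\<^sup>+\<^sup>1\<close>.
\<close>

lemma upper_central_subset_iterated_centralizer:
  assumes H: "subgroup H G"
    and central: "\<forall>m\<le>j. iterated_centralizer G H m = upper_central G m"
    and "n \<le> Suc j"
  shows "upper_central (G\<lparr>carrier := H\<rparr>) n \<subseteq> iterated_centralizer G H n"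
  using \<open>n \<le> Suc j\<close>
proof (induction n)
  case (Suc n)
  have IH: "upper_central (G\<lparr>carrier := H\<rparr>) n \<subseteq> upper_central G n"
    using Suc central by simp
  have "upper_central (G\<lparr>carrier := H\<rparr>) (Suc n)
      = H \<inter> centralizer_mod G (upper_central (G\<lparr>carrier := H\<rparr>) n) H"
    unfolding upper_central_Suc_eq by (simp add: centralizer_mod_restrict[OF H])
  also have "\<dots> \<subseteq> centralizer_mod G (upper_central G n) H"
    using IH by (auto simp: centralizer_mod_def)
  also have "\<dots> = iterated_centralizer G H (Suc n)"
    using iterated_centralizer_Suc_eq[of n H] central Suc.prems by simp
  finally show ?case .
qed simp

section \<open>One step of the envelope construction\<close>

text \<open>
  Commuting modulo \<open>N\<close> is symmetric, so centralizers modulo \<open>N\<close> form a Galois connection and this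
  is its unit.
\<close>

lemma subset_double_centralizer_mod:
  assumes "subgroup N G" "A \<subseteq> carrier G"
  shows "A \<subseteq> centralizer_mod G N (centralizer_mod G N A)"
  using assms commutator_mem_swap by (fastforce simp: centralizer_mod_def)

text \<open>
  Here \<open>G\<close> plays the role of one envelope and \<open>E\<close> that of the next. The third conclusion
  re-establishes the invariant one level higher. The fourth is the reason at the new level: \<open>E\<close> is the
  centralizer of \<open>C\<close> modulo \<open>Z\<^sub>j(G)\<close>, so by symmetry the elements of \<open>E\<close> that lie in \<open>C\<close> are
  central in \<open>E\<close> modulo \<open>Z\<^sub>j(G)\<close>.
\<close>

lemma double_centralizer_step:
  fixes H :: "'a set" and j :: nat
  defines "C \<equiv> centralizer_mod G (upper_central G j) H"
  defines "E \<equiv> centralizer_mod G (upper_central G j) C"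
  assumes H: "subgroup H G"
    and central: "\<forall>m\<le>j. iterated_centralizer G H m = upper_central G m"
  shows "subgroup E G" and "H \<subseteq> E"
    and "\<forall>m\<le>Suc j.
      iterated_centralizer (G\<lparr>carrier := E\<rparr>) H m = upper_central (G\<lparr>carrier := E\<rparr>) m"
    and "E \<inter> C \<subseteq> upper_central (G\<lparr>carrier := E\<rparr>) (Suc j)"
proof -
  let ?E = "G\<lparr>carrier := E\<rparr>"
  have C: "C \<subseteq> carrier G" by (auto simp: C_def centralizer_mod_def)
  show E: "subgroup E G"
    unfolding E_def by (rule subgroup_centralizer_mod[OF upper_central_normal C])
  show HE: "H \<subseteq> E"
    unfolding E_def C_def
    using subset_double_centralizer_mod normal_imp_subgroup[OF upper_central_normal]
      subgroup.subset[OF H] by blast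
  interpret E: group ?E by (rule subgroup_imp_group[OF E])
  \<comment> \<open>Up to level \<open>j\<close> both series of \<open>E\<close> are traces of the series of \<open>G\<close>: the trace of \<open>Z\<^sub>m(G)\<close> is
    always inside \<open>Z\<^sub>m(E)\<close>, which is inside \<open>C\<^sup>m\<close> of \<open>E\<close> since \<open>H \<subseteq> E\<close>, and the invariant in \<open>G\<close>
    closes the circle.\<close>
  have low: "iterated_centralizer ?E H m = E \<inter> upper_central G m \<and>
      upper_central ?E m = E \<inter> upper_central G m" if "m \<le> j" for m
    using that
  proof (induction m rule: less_induct)
    case (less m)
    show ?case
    proof (cases m)
      case 0
      then show ?thesis using subgroup.one_closed[OF E] by auto
    next
      case (Suc n)
      have C_m: "iterated_centralizer ?E H m = centralizer_mod ?E (upper_central ?E n) H"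
        unfolding Suc using less Suc by (intro E.iterated_centralizer_Suc_eq) auto
      note C_m
      also have "centralizer_mod ?E (upper_central ?E n) H
          = E \<inter> centralizer_mod G (upper_central G n) H"
        using less Suc by (simp add: centralizer_mod_restrict[OF E HE] centralizer_mod_inter[OF E HE])
      also have "\<dots> = E \<inter> upper_central G m"
        using iterated_centralizer_Suc_eq[of n H] central less.prems
        unfolding Suc by simp
      finally have C_m': "iterated_centralizer ?E H m = E \<inter> upper_central G m" .
      have "upper_central ?E m \<subseteq> centralizer_mod ?E (upper_central ?E n) H"
        unfolding Suc upper_central_Suc_eq using centralizer_mod_antimono[of H "carrier ?E"] HE by simp
      also have "\<dots> = E \<inter> upper_central G m"
        using C_m C_m' by simp
      finally show ?thesis using C_m' upper_central_inter_subset[OF E] by blast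
    qed
  qed
  have top: "iterated_centralizer ?E H (Suc j) = E \<inter> C"
  proof -
    have "iterated_centralizer ?E H (Suc j) = centralizer_mod ?E (upper_central ?E j) H"
      using low by (intro E.iterated_centralizer_Suc_eq) auto
    then show ?thesis
      using low[of j] unfolding C_def
      by (simp add: centralizer_mod_restrict[OF E HE] centralizer_mod_inter[OF E HE])
  qed
  show EC: "E \<inter> C \<subseteq> upper_central ?E (Suc j)"
  proof -
    have "E \<inter> C \<subseteq> E \<inter> centralizer_mod G (upper_central G j) E"
      unfolding E_def
      using subset_double_centralizer_mod[OF normal_imp_subgroup[OF upper_central_normal[of j]] C]
      by blast
    then show ?thesis
      unfolding upper_central_Suc_eq using low[of j]
      by (simp add: centralizer_mod_restrict[OF E] centralizer_mod_inter[OF E])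
  qed
  have "upper_central ?E (Suc j) \<subseteq> centralizer_mod ?E (upper_central ?E j) H"
    unfolding upper_central_Suc_eq using centralizer_mod_antimono[of H "carrier ?E"] HE by simp
  also have "\<dots> = E \<inter> C"
    using low E.iterated_centralizer_Suc_eq[of j H] top by auto
  finally have "iterated_centralizer ?E H (Suc j) = upper_central ?E (Suc j)"
    using top EC by blast
  with low show "\<forall>m\<le>Suc j. iterated_centralizer ?E H m = upper_central ?E m"
    by (metis le_SucE)
qed

section \<open>The envelopes\<close>

text \<open>
  Under the invariant, passing to the next envelope is taking a double centralizer modulo the
  \<open>j\<close>-th centre of the current one. All later arguments use this description.
\<close>

lemma envelope_Suc_eq:
  fixes H :: "'a set" and j :: nat
  defines "K \<equiv> G\<lparr>carrier := envelope G H j\<rparr>"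
  assumes E: "subgroup (envelope G H j) G"
    and central: "\<forall>m\<le>j. iterated_centralizer K H m = upper_central K m"
  shows "envelope G H (Suc j)
    = centralizer_mod K (upper_central K j) (centralizer_mod K (upper_central K j) H)"
proof -
  interpret K: group K unfolding K_def by (rule subgroup_imp_group[OF E])
  have C: "iterated_centralizer K H (Suc j) = centralizer_mod K (upper_central K j) H"
    by (rule K.iterated_centralizer_Suc_eq[OF central])
  have "centralizer_mod K (upper_central K j) H \<subseteq> envelope G H j"
    by (auto simp: centralizer_mod_def K_def)
  then have "centralizer_mod K (upper_central K j) (centralizer_mod K (upper_central K j) H)
    = envelope G H j \<inter> centralizer_mod G (upper_central K j) (iterated_centralizer K H (Suc j))"
    unfolding C unfolding K_def by (rule centralizer_mod_restrict[OF E])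
  also have "\<dots> = envelope G H (Suc j)"
    using central subgroup.subset[OF E]
    by (auto simp: envelope.simps(2) centralizer_mod_def commutator_set_subset_iff K_def)
  finally show ?thesis ..
qed

lemma envelope_invariant:
  assumes H: "subgroup H G"
  shows "subgroup (envelope G H j) G" and "H \<subseteq> envelope G H j"
    and "\<forall>m\<le>j. iterated_centralizer (G\<lparr>carrier := envelope G H j\<rparr>) H m
      = upper_central (G\<lparr>carrier := envelope G H j\<rparr>) m"
proof (induction j)
  case 0
  case 1 show ?case using subgroup_self by simp
  case 2 show ?case using subgroup.subset[OF H] by simp
  case 3 show ?case by simp
next
  case (Suc j)
  let ?K = "G\<lparr>carrier := envelope G H j\<rparr>"
  interpret K: group ?K by (rule subgroup_imp_group[OF Suc(1)])
  have HK: "subgroup H ?K" by (rule subgroup_incl[OF H Suc(1,2)])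
  note step = K.double_centralizer_step[OF HK Suc(3), folded envelope_Suc_eq[OF Suc(1,3)]]
  case 1 show ?case using incl_subgroup[OF Suc(1)] step(1) by blast
  case 2 show ?case by (rule step(2))
  case 3 show ?case using step(3) by simp
qed

text \<open>
  The hypothesis makes \<open>H\<close> abelian modulo \<open>Z\<^sub>j(E\<^sub>j)\<close>, that is \<open>H \<subseteq> C\<close>. Centralizing reverses
  inclusions, so the double centralizer of \<open>H\<close> lies in \<open>C\<close>, where its elements are central modulo
  \<open>Z\<^sub>j(E\<^sub>j)\<close>.
\<close>

lemma upper_central_envelope:
  assumes H: "subgroup H G" and nil: "upper_central (G\<lparr>carrier := H\<rparr>) (Suc j) = H"
  shows "upper_central (G\<lparr>carrier := envelope G H (Suc j)\<rparr>) (Suc j) = envelope G H (Suc j)"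
proof -
  let ?K = "G\<lparr>carrier := envelope G H j\<rparr>"
  let ?C = "centralizer_mod ?K (upper_central ?K j) H"
  let ?E = "envelope G H (Suc j)"
  note inv = envelope_invariant[OF H]
  interpret K: group ?K by (rule subgroup_imp_group[OF inv(1)])
  have HK: "subgroup H ?K" by (rule subgroup_incl[OF H inv(1,2)])
  have E: "?E = centralizer_mod ?K (upper_central ?K j) ?C"
    by (rule envelope_Suc_eq[OF inv(1,3)])
  have "H \<subseteq> iterated_centralizer ?K H (Suc j)"
    using K.upper_central_subset_iterated_centralizer[OF HK inv(3), of "Suc j"] nil by simp
  then have "H \<subseteq> ?C"
    using K.iterated_centralizer_Suc_eq[OF inv(3)] by blast
  then have "?E \<subseteq> ?C"
    unfolding E by (rule centralizer_mod_antimono)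
  then have "?E \<subseteq> upper_central (G\<lparr>carrier := ?E\<rparr>) (Suc j)"
    using K.double_centralizer_step(4)[OF HK inv(3), folded E]
    by (simp add: Int_absorb2)
  moreover have "upper_central (G\<lparr>carrier := ?E\<rparr>) (Suc j) \<subseteq> ?E"
    using group.upper_central_subset_carrier[OF subgroup_imp_group[OF inv(1)[of "Suc j"]]] by simp
  ultimately show ?thesis by blast
qed

end

theorem theorem1:
  fixes G :: "('a, 'b) monoid_scheme" and H :: "'a set" and k :: nat
  assumes "group G"
    and "subgroup H G"
    and "k \<ge> 1"
    and "k_nilpotent k (G\<lparr>carrier := H\<rparr>)"
  shows "k_nilpotent k (G\<lparr>carrier := envelope G H k\<rparr>)"
proof -
  interpret group G by fact
  let ?H = "G\<lparr>carrier := H\<rparr>"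
  let ?E = "G\<lparr>carrier := envelope G H k\<rparr>"
  note inv = envelope_invariant[OF \<open>subgroup H G\<close>]
  have "\<exists>j. upper_central ?H j = H" and class_H: "(LEAST j. upper_central ?H j = H) = k"
    using assms(4) by (auto simp: k_nilpotent_def nilpotent_group_def nilpotency_class_def)
  then have "upper_central ?H k = H"
    by (metis (mono_tags, lifting) LeastI_ex)
  moreover obtain j where "k = Suc j"
    using \<open>k \<ge> 1\<close> by (cases k) auto
  ultimately have Z: "upper_central ?E k = envelope G H k"
    using upper_central_envelope[OF \<open>subgroup H G\<close>, of j] by simp
  \<comment> \<open>The class does not drop: \<open>Z\<^sub>i(E\<^sub>k) = E\<^sub>k\<close> forces \<open>Z\<^sub>i(H) = H\<close> for the subgroup \<open>H\<close>.\<close>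
  have "k \<le> i" if i: "upper_central ?E i = envelope G H k" for i
  proof -
    interpret E: group ?E by (rule subgroup_imp_group[OF inv(1)])
    have "H \<subseteq> upper_central ?H i"
      using E.upper_central_inter_subset[OF subgroup_incl[OF \<open>subgroup H G\<close> inv(1,2)], of i]
        inv(2)[of k] i by auto
    moreover have "upper_central ?H i \<subseteq> H"
      using group.upper_central_subset_carrier[OF subgroup_imp_group[OF \<open>subgroup H G\<close>]]
      by simp
    ultimately have "upper_central ?H i = H" by blast
    then show ?thesis using class_H Least_le[of "\<lambda>i. upper_central ?H i = H" i] by simp
  qed
  with Z have "(LEAST i. upper_central ?E i = envelope G H k) = k"
    by (intro Least_equality)
  then show ?thesis
    using Z subgroup_imp_group[OF inv(1)]
    by (auto simp: k_nilpotent_def nilpotent_group_def nilpotency_class_def)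
qed

end
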